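(* Let $n\geq 3$, let $\chi_1,\dots,\chi_n$ be characters of $\mathbb{F}_q^\times$, and put $\underline{\chi}_n=(\chi_1,\dots,\chi_n)$, $\underline{\chi}_{n-1}=(\chi_1,\dots,\chi_{n-1})$. Then for every $a_n\in\mathbb{F}_q^\times$, $$\Psi^{GL_n}_{\underline{\chi}_n}(g_{n-1,1}(1,a_n))=C'_n\sum_{t_{n-1}\in\mathbb{F}_q^\times}\chi_n\Big(-\frac{a_n}{t_{n-1}}\Big)\,\psi\Big(-\frac{t_{n-1}}{a_n}\Big)\,\Psi^{GL_{n-1}}_{\underline{\chi}_{n-1}}(g_{n-2,1}(1,t_{n-1})),$$ where $C'_n=\dfrac{q^{n-2}(q-1)}{q^n-1}$.
   Context: Let $\mathbb{F}_q$ be a finite field, $q$ a power of an odd prime, and $\psi:\mathbb{F}_q\to\mathbb{C}^\times$ a nontrivial additive character. For each $m\ge 2$ let $G_m=GL(m,\mathbb{F}_q)$, $U_m$ the subgroup of upper-triangular unipotent matrices, $B_m^-$ the subgroup of lower-triangular invertible matrices; extend $\psi$ to a character of $U_m$ by $\psi(u)=\psi(\sum_{i=1}^{m-1}u_{i,i+1})$. For $\underline{\chi}_m=(\chi_1,\dots,\chi_m)$, with $\chi_i$ characters of $\mathbb{F}_q^\times$, let $\underline{\chi}_m(b)=\prod_{i=1}^m\chi_i(b_{ii})$ for $b\in B_m^-$, and let $\mathcal{V}_{\underline{\chi}_m}=\{f:G_m\to\mathbb{C}\mid f(bg)=\underline{\chi}_m(b)f(g)\ \forall b\in B_m^-,g\in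 G_m\}$, on which $\pi_{\underline{\chi}_m}$ acts by right translation, with inner product $\langle f_1,f_2\rangle=\frac{1}{|G_m|}\sum_{g\in G_m}f_1(g)\overline{f_2(g)}$. The Whittaker vector $\psi_m\in\mathcal{V}_{\underline{\chi}_m}$ is given by $\psi_m(bu)=\underline{\chi}_m(b)\psi(u)$ for $b\in B_m^-,u\in U_m$, and $\psi_m=0$ outside $B_m^-U_m$. The Whittaker function is $$\Psi^{GL_m}_{\underline{\chi}_m}(g)=\langle\pi_{\underline{\chi}_m}(g)\psi_m,\psi_m\rangle=\frac{1}{[G_m:B_m^-]}\sum_{u\in U_m}\psi_m(ug)\overline{\psi(u)},\qquad g\in G_m.$$ For $c_1,c_2\in\mathbb{F}_q^\times$, $g_{m-1,1}(c_1,c_2)\in G_m$ is the block anti-diagonal matrix $\begin{pmatrix}0&c_1I_{m-1}\\ c_2&0\end{pmatrix}$. *)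

theory Defs
  imports Complex_Main "HOL-Library.Cardinality" "HOL-Computational_Algebra.Primes" "Jordan_Normal_Form.Determinant"
begin

definition GL :: "nat \<Rightarrow> 'a::field mat set" where
  "GL m = {g \<in> carrier_mat m m. invertible_mat g}"

definition upper_unipotent :: "nat \<Rightarrow> 'a::field mat set" where
  "upper_unipotent m = {u \<in> GL m. upper_triangular u \<and> (\<forall>i<m. u $$ (i, i) = 1)}"

definition lower_borel :: "nat \<Rightarrow> 'a::field mat set" where
  "lower_borel m = {b \<in> GL m. \<forall>i<m. \<forall>j<m. i < j \<longrightarrow> b $$ (i, j) = 0}"

definition additive_character :: "('a::field \<Rightarrow> complex) \<Rightarrow> bool" where
  "additive_character \<psi> \<longleftrightarrow>
     (\<forall>x. \<psi> x \<noteq> 0) \<and> (\<forall>x y. \<psi> (x + y) = \<psi> x * \<psi> y)"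

text \<open>Characters of the group of nonzero elements; the value at \<open>0\<close> is unconstrained.\<close>
definition multiplicative_character :: "('a::field \<Rightarrow> complex) \<Rightarrow> bool" where
  "multiplicative_character \<chi> \<longleftrightarrow>
     (\<forall>x. x \<noteq> 0 \<longrightarrow> \<chi> x \<noteq> 0) \<and>
     (\<forall>x y. x \<noteq> 0 \<longrightarrow> y \<noteq> 0 \<longrightarrow> \<chi> (x * y) = \<chi> x * \<chi> y)"

definition unipotent_char :: "nat \<Rightarrow> ('a::field \<Rightarrow> complex) \<Rightarrow> 'a mat \<Rightarrow> complex" where
  "unipotent_char m \<psi> u = \<psi> (\<Sum>i<m - 1. u $$ (i, Suc i))"

text \<open>Tuples of characters are indexed from \<open>1\<close>, matrix entries from \<open>0\<close>. Only
  \<open>\<chi> 1, \<dots>, \<chi> m\<close> enter the constructions for \<open>GL m\<close>, so the truncation of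
  \<open>(\<chi> 1, \<dots>, \<chi> n)\<close> to its first \<open>n - 1\<close> entries is given by the same \<open>\<chi>\<close>.\<close>
definition borel_char :: "nat \<Rightarrow> (nat \<Rightarrow> 'a::field \<Rightarrow> complex) \<Rightarrow> 'a mat \<Rightarrow> complex" where
  "borel_char m \<chi> b = (\<Prod>i\<in>{1..m}. \<chi> i (b $$ (i - 1, i - 1)))"

text \<open>Functions on \<open>GL m\<close> are total functions on matrices, of which only the values on
  \<open>GL m\<close> are used.\<close>
definition principal_series ::
  "nat \<Rightarrow> (nat \<Rightarrow> 'a::field \<Rightarrow> complex) \<Rightarrow> ('a mat \<Rightarrow> complex) set" where
  "principal_series m \<chi> =
     {f. \<forall>b\<in>lower_borel m. \<forall>g\<in>GL m. f (b * g) = borel_char m \<chi> b * f g}"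

definition right_translation ::
  "'a::field mat \<Rightarrow> ('a mat \<Rightarrow> complex) \<Rightarrow> 'a mat \<Rightarrow> complex" where
  "right_translation g f = (\<lambda>x. f (x * g))"

definition GL_inner ::
  "nat \<Rightarrow> ('a::{field,finite} mat \<Rightarrow> complex) \<Rightarrow> ('a mat \<Rightarrow> complex) \<Rightarrow> complex" where
  "GL_inner m f1 f2 =
     (\<Sum>g\<in>GL m. f1 g * cnj (f2 g)) / of_nat (card (GL m :: 'a mat set))"

text \<open>The value on \<open>b * u\<close> does not depend on the decomposition; see
  \<open>whittaker_vector_mult\<close> below.\<close>
definition whittaker_vector ::
  "nat \<Rightarrow> (nat \<Rightarrow> 'a::field \<Rightarrow> complex) \<Rightarrow> ('a \<Rightarrow> complex) \<Rightarrow> 'a mat \<Rightarrow> complex" where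
  "whittaker_vector m \<chi> \<psi> g =
     (if \<exists>b\<in>lower_borel m. \<exists>u\<in>upper_unipotent m. g = b * u
      then THE z. \<exists>b\<in>lower_borel m. \<exists>u\<in>upper_unipotent m.
             g = b * u \<and> z = borel_char m \<chi> b * unipotent_char m \<psi> u
      else 0)"

definition whittaker_function ::
  "nat \<Rightarrow> (nat \<Rightarrow> 'a::{field,finite} \<Rightarrow> complex) \<Rightarrow> ('a \<Rightarrow> complex) \<Rightarrow> 'a mat \<Rightarrow> complex" where
  "whittaker_function m \<chi> \<psi> g =
     GL_inner m (right_translation g (whittaker_vector m \<chi> \<psi>)) (whittaker_vector m \<chi> \<psi>)"

text \<open>The block anti-diagonal matrix of size \<open>m\<close> (for \<open>m \<ge> 1\<close>) with upper right block
  \<open>c1\<close> times the identity of size \<open>m - 1\<close> and lower left entry \<open>c2\<close>.\<close>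
definition antidiag_block :: "nat \<Rightarrow> 'a::field \<Rightarrow> 'a \<Rightarrow> 'a mat" where
  "antidiag_block m c1 c2 =
     four_block_mat (0\<^sub>m (m - 1) 1) (c1 \<cdot>\<^sub>m 1\<^sub>m (m - 1))
                    (c2 \<cdot>\<^sub>m 1\<^sub>m 1) (0\<^sub>m 1 (m - 1))"

lemma finite_carrier_mat: "finite (carrier_mat m n :: 'a::finite mat set)"
proof -
  have "carrier_mat m n \<subseteq> (\<lambda>f. mat m n f) ` (PiE ({..<m} \<times> {..<n}) (\<lambda>_. UNIV :: 'a set))"
  proof
    fix A :: "'a mat" assume A: "A \<in> carrier_mat m n"
    have "A = mat m n (restrict (\<lambda>ij. A $$ ij) ({..<m} \<times> {..<n}))"
      using A by (intro eq_matI) auto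
    then show "A \<in> (\<lambda>f. mat m n f) ` (PiE ({..<m} \<times> {..<n}) (\<lambda>_. UNIV :: 'a set))"
      by auto
  qed
  then show ?thesis
    by (rule finite_subset) (intro finite_imageI finite_PiE, auto)
qed

lemma finite_GL: "finite (GL m :: 'a::{field,finite} mat set)"
  by (rule finite_subset[OF _ finite_carrier_mat]) (auto simp: GL_def)

lemma invertible_mat_det_iff:
  fixes A :: "'a::field mat"
  assumes A: "A \<in> carrier_mat m m"
  shows "invertible_mat A \<longleftrightarrow> det A \<noteq> 0"
proof
  assume "invertible_mat A"
  then obtain B where B: "A * B = 1\<^sub>m m" "B * A = 1\<^sub>m (dim_row B)"
    using A by (auto simp: invertible_mat_def inverts_mat_def)
  have "dim_row B = dim_col A"
    using B(2) by (metis index_mult_mat(3) index_one_mat(3))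
  moreover have "dim_col B = m"
    using B(1) by (metis index_mult_mat(3) index_one_mat(3))
  ultimately have "B \<in> carrier_mat m m" using A by auto
  then have "det A * det B = 1" using det_mult[OF A] B(1) by (metis det_one)
  then show "det A \<noteq> 0" by auto
next
  assume "det A \<noteq> 0"
  from det_non_zero_imp_unit[OF A this, of undefined]
  obtain B where "B \<in> carrier_mat m m" "A * B = 1\<^sub>m m" "B * A = 1\<^sub>m m"
    unfolding Units_def by (auto simp: ring_mat_def)
  then show "invertible_mat A"
    using A by (auto simp: invertible_mat_def inverts_mat_def)
qed

lemma GL_mult: "g \<in> GL m \<Longrightarrow> h \<in> GL m \<Longrightarrow> g * h \<in> GL m"
  by (auto simp: GL_def invertible_mat_det_iff det_mult invertible_mat_det_iff[of "g * h" m])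

lemma lower_borel_diag_nonzero:
  assumes "b \<in> lower_borel m" "i < m"
  shows "b $$ (i, i) \<noteq> 0"
proof -
  have b: "b \<in> carrier_mat m m" "invertible_mat b"
      "\<And>i j. i < j \<Longrightarrow> j < m \<Longrightarrow> b $$ (i, j) = 0"
    using assms(1) by (auto simp: lower_borel_def GL_def)
  have "prod_list (diag_mat b) \<noteq> 0"
    using det_lower_triangular[OF b(3) b(1)] b invertible_mat_det_iff[OF b(1)] by simp
  then show ?thesis using assms(2) b(1) by (auto simp: diag_mat_def prod_list_zero_iff)
qed

lemma lower_borel_mult_entry:
  assumes "b \<in> lower_borel m" "A \<in> carrier_mat m m" "i < m" "j < m"
  shows "(b * A) $$ (i, j) = (\<Sum>l\<le>i. b $$ (i, l) * A $$ (l, j))"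
proof -
  have b: "b \<in> carrier_mat m m" "\<And>l. i < l \<Longrightarrow> l < m \<Longrightarrow> b $$ (i, l) = 0"
    using assms by (auto simp: lower_borel_def GL_def)
  have "(b * A) $$ (i, j) = (\<Sum>l<m. b $$ (i, l) * A $$ (l, j))"
    using assms b(1) by (auto simp: scalar_prod_def atLeast0LessThan)
  also have "\<dots> = (\<Sum>l\<le>i. b $$ (i, l) * A $$ (l, j))"
    using assms b by (intro sum.mono_neutral_right) auto
  finally show ?thesis .
qed

lemma lower_borel_mult:
  assumes b: "b \<in> lower_borel m" and c: "c \<in> lower_borel m"
  shows "b * c \<in> lower_borel m"
    and "i < m \<Longrightarrow> (b * c) $$ (i, i) = b $$ (i, i) * c $$ (i, i)"
proof -
  have cc: "c \<in> carrier_mat m m" "\<And>i j. i < j \<Longrightarrow> j < m \<Longrightarrow> c $$ (i, j) = 0"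
    using c by (auto simp: lower_borel_def GL_def)
  have "(b * c) $$ (i, j) = 0" if "i < j" "j < m" for i j
    using that cc by (subst lower_borel_mult_entry[OF b cc(1)]) auto
  moreover have "b * c \<in> GL m" using b c GL_mult by (auto simp: lower_borel_def)
  ultimately show "b * c \<in> lower_borel m" by (auto simp: lower_borel_def)
  assume i: "i < m"
  have "(\<Sum>l\<le>i. b $$ (i, l) * c $$ (l, i)) = (\<Sum>l\<in>{i}. b $$ (i, l) * c $$ (l, i))"
    using i cc by (intro sum.mono_neutral_right) auto
  then show "(b * c) $$ (i, i) = b $$ (i, i) * c $$ (i, i)"
    using lower_borel_mult_entry[OF b cc(1) i i] by simp
qed

lemma borel_unipotent_unique:
  assumes b: "b \<in> lower_borel m" "b' \<in> lower_borel m"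
    and u: "u \<in> upper_unipotent m" "u' \<in> upper_unipotent m"
    and eq: "b * u = b' * u'"
  shows "b = b'" "u = u'"
proof -
  have car: "b \<in> carrier_mat m m" "b' \<in> carrier_mat m m" "u \<in> carrier_mat m m" "u' \<in> carrier_mat m m"
    and u1: "\<And>i. i < m \<Longrightarrow> u $$ (i, i) = 1" "\<And>i. i < m \<Longrightarrow> u' $$ (i, i) = 1"
    and u0: "\<And>i j. j < i \<Longrightarrow> i < m \<Longrightarrow> u $$ (i, j) = 0" "\<And>i j. j < i \<Longrightarrow> i < m \<Longrightarrow> u' $$ (i, j) = 0"
    and b0: "\<And>i j. i < j \<Longrightarrow> j < m \<Longrightarrow> b $$ (i, j) = 0" "\<And>i j. i < j \<Longrightarrow> j < m \<Longrightarrow> b' $$ (i, j) = 0"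
    using b u by (auto simp: lower_borel_def upper_unipotent_def GL_def)
  have e: "(\<Sum>l\<le>i. b $$ (i, l) * u $$ (l, j)) = (\<Sum>l\<le>i. b' $$ (i, l) * u' $$ (l, j))"
    if "i < m" "j < m" for i j
    using lower_borel_mult_entry[OF b(1) car(3) that] lower_borel_mult_entry[OF b(2) car(4) that] eq
    by simp
  have main: "k < m \<Longrightarrow> (\<forall>i<m. b $$ (i, k) = b' $$ (i, k)) \<and> (\<forall>j<m. u $$ (k, j) = u' $$ (k, j))" for k
  proof (induction k rule: less_induct)
    case (less k)
    have IHb: "b $$ (i, l) = b' $$ (i, l)" if "l < k" "i < m" for i l
      using less that by auto
    have IHu: "u $$ (l, j) = u' $$ (l, j)" if "l < k" "j < m" for j l
      using less that by auto
    have bk: "b $$ (i, k) = b' $$ (i, k)" if i: "i < m" for i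
    proof (cases "k \<le> i")
      case True
      have trunc: "(\<Sum>l\<le>i. c $$ (i, l) * v $$ (l, k)) = (\<Sum>l<k. c $$ (i, l) * v $$ (l, k)) + c $$ (i, k)"
        if "\<And>i j. j < i \<Longrightarrow> i < m \<Longrightarrow> v $$ (i, j) = 0" "v $$ (k, k) = 1" for c v :: "'a mat"
      proof -
        have "(\<Sum>l\<le>i. c $$ (i, l) * v $$ (l, k)) = (\<Sum>l\<le>k. c $$ (i, l) * v $$ (l, k))"
          using True i that(1) by (intro sum.mono_neutral_right) auto
        then show ?thesis using that(2) by (simp add: lessThan_Suc_atMost[symmetric])
      qed
      have "(\<Sum>l<k. b $$ (i, l) * u $$ (l, k)) = (\<Sum>l<k. b' $$ (i, l) * u' $$ (l, k))"
        using IHb IHu i less.prems by (intro sum.cong) auto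
      then show ?thesis
        using e[OF i less.prems] trunc[of u b, OF u0(1) u1(1)[OF less.prems]]
          trunc[of u' b', OF u0(2) u1(2)[OF less.prems]] by simp
    next
      case False
      then show ?thesis using b0 less.prems by simp
    qed
    have "u $$ (k, j) = u' $$ (k, j)" if j: "j < m" for j
    proof -
      have "(\<Sum>l<k. b $$ (k, l) * u $$ (l, j)) = (\<Sum>l<k. b' $$ (k, l) * u' $$ (l, j))"
        using IHb IHu j less.prems by (intro sum.cong) auto
      then have "b $$ (k, k) * u $$ (k, j) = b' $$ (k, k) * u' $$ (k, j)"
        using e[OF less.prems j] by (simp add: lessThan_Suc_atMost[symmetric])
      then show ?thesis
        using bk[OF less.prems] lower_borel_diag_nonzero[OF b(1) less.prems] by simp
    qed
    with bk show ?case by blast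
  qed
  show "b = b'" using car main by (intro eq_matI) auto
  show "u = u'" using car main by (intro eq_matI) auto
qed

lemma whittaker_vector_mult:
  assumes "b \<in> lower_borel m" "u \<in> upper_unipotent m"
  shows "whittaker_vector m \<chi> \<psi> (b * u) = borel_char m \<chi> b * unipotent_char m \<psi> u"
proof -
  have "(THE z. \<exists>b'\<in>lower_borel m. \<exists>u'\<in>upper_unipotent m.
          b * u = b' * u' \<and> z = borel_char m \<chi> b' * unipotent_char m \<psi> u')
        = borel_char m \<chi> b * unipotent_char m \<psi> u"
    using assms by (intro the_equality) (use borel_unipotent_unique in blast)+
  then show ?thesis using assms unfolding whittaker_vector_def by auto
qed

lemma borel_char_mult:
  assumes \<chi>: "\<And>i. i \<in> {1..m} \<Longrightarrow> multiplicative_character (\<chi> i)"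
    and b: "b \<in> lower_borel m" "c \<in> lower_borel m"
  shows "borel_char m \<chi> (b * c) = borel_char m \<chi> b * borel_char m \<chi> c"
  unfolding borel_char_def prod.distrib[symmetric]
proof (rule prod.cong[OF refl])
  fix i assume i: "i \<in> {1..m}"
  then have "i - 1 < m" by auto
  then show "\<chi> i ((b * c) $$ (i - 1, i - 1))
      = \<chi> i (b $$ (i - 1, i - 1)) * \<chi> i (c $$ (i - 1, i - 1))"
    using \<chi>[OF i] lower_borel_mult(2)[OF b] lower_borel_diag_nonzero[OF b(1)]
      lower_borel_diag_nonzero[OF b(2)]
    by (simp add: multiplicative_character_def)
qed

lemma lower_borel_inverse:
  assumes "b \<in> lower_borel m"
  obtains c where "c \<in> lower_borel m" "c * b = 1\<^sub>m m"
proof -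
  have bc: "b \<in> carrier_mat m m" "invertible_mat b" using assms by (auto simp: lower_borel_def GL_def)
  from det_non_zero_imp_unit[OF bc(1), of undefined] bc invertible_mat_det_iff[OF bc(1)]
  obtain c where c: "c \<in> carrier_mat m m" "b * c = 1\<^sub>m m" "c * b = 1\<^sub>m m"
    unfolding Units_def by (auto simp: ring_mat_def)
  have "invertible_mat c" using bc c by (auto simp: invertible_mat_def inverts_mat_def)
  moreover have "i < j \<Longrightarrow> j < m \<Longrightarrow> c $$ (i, j) = 0" for i j
  proof (induction i rule: less_induct)
    case (less i)
    have "(\<Sum>l\<le>i. b $$ (i, l) * c $$ (l, j)) = 0"
      using lower_borel_mult_entry[OF assms c(1), of i j] less.prems c(2) by simp
    moreover have "(\<Sum>l<i. b $$ (i, l) * c $$ (l, j)) = 0"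
      using less by (intro sum.neutral) auto
    ultimately show ?case
      using lower_borel_diag_nonzero[OF assms, of i] less.prems
      by (simp add: lessThan_Suc_atMost[symmetric])
  qed
  ultimately have "c \<in> lower_borel m" using c by (auto simp: lower_borel_def GL_def)
  with c that show ?thesis by blast
qed

lemma whittaker_vector_in_principal_series:
  assumes \<chi>: "\<And>i. i \<in> {1..m} \<Longrightarrow> multiplicative_character (\<chi> i)"
  shows "whittaker_vector m \<chi> \<psi> \<in> principal_series m \<chi>"
  unfolding principal_series_def
proof (intro CollectI ballI)
  fix b g :: "'a mat" assume b: "b \<in> lower_borel m" and g: "g \<in> GL m"
  note car = lower_borel_def upper_unipotent_def GL_def
  show "whittaker_vector m \<chi> \<psi> (b * g) = borel_char m \<chi> b * whittaker_vector m \<chi> \<psi> g"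
  proof (cases "\<exists>c\<in>lower_borel m. \<exists>u\<in>upper_unipotent m. g = c * u")
    case True
    then obtain c u where cu: "c \<in> lower_borel m" "u \<in> upper_unipotent m" "g = c * u" by blast
    have "b * g = (b * c) * u"
      using b cu by (simp add: car) (metis assoc_mult_mat)
    then show ?thesis
      using whittaker_vector_mult[OF lower_borel_mult(1)[OF b cu(1)] cu(2)]
        whittaker_vector_mult[OF cu(1,2)] borel_char_mult[OF \<chi> b cu(1)] cu(3) by simp
  next
    case False
    have "\<not> (\<exists>c\<in>lower_borel m. \<exists>u\<in>upper_unipotent m. b * g = c * u)"
    proof
      assume "\<exists>c\<in>lower_borel m. \<exists>u\<in>upper_unipotent m. b * g = c * u"
      then obtain c u where cu: "c \<in> lower_borel m" "u \<in> upper_unipotent m" "b * g = c * u" by blast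
      obtain d where d: "d \<in> lower_borel m" "d * b = 1\<^sub>m m" using lower_borel_inverse[OF b] .
      have k: "d \<in> carrier_mat m m" "b \<in> carrier_mat m m" "c \<in> carrier_mat m m"
          "u \<in> carrier_mat m m" "g \<in> carrier_mat m m"
        using b d cu g by (auto simp: car)
      have "g = (d * b) * g" using d k by simp
      also have "\<dots> = d * (b * g)" using k by (intro assoc_mult_mat) auto
      also have "\<dots> = (d * c) * u" using k cu(3) by (simp add: assoc_mult_mat[of _ m m _ m _ m])
      finally show False using False lower_borel_mult(1)[OF d(1) cu(1)] cu(2) by blast
    qed
    with False show ?thesis by (simp add: whittaker_vector_def)
  qed
qed

end

theory Submission
  imports Defs
begin

text \<open>
  Write \<open>n = m + 1\<close>. Summing over \<open>B U\<close> reduces the Whittaker function at the antidiagonal element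
  \<open>h = g(1, a)\<close> to \<open>|B| / |G|\<close> times the sum over \<open>u \<in> U\<close> of \<open>\<psi>\<^sub>n (u h) \<psi>(u)\<^sup>-\<^sup>1\<close>. The columns of \<open>u h\<close>
  are \<open>z, u\<^sub>0, \<dots>, u\<^bsub>m-1\<^esub>\<close> with \<open>z = a u\<^sub>m\<close>, and if \<open>c u h\<close> is upper unipotent with \<open>c\<close> lower
  triangular then \<open>c\<close> is forced to be bidiagonal, with ones below the diagonal and diagonal
  \<open>1 / z\<^sub>0, - z\<^sub>0 / z\<^sub>1, \<dots>, - z\<^bsub>m-1\<^esub> / z\<^sub>m\<close>. So \<open>u h\<close> lies in the big cell exactly when no \<open>z\<^sub>k\<close>
  vanishes, the entries of \<open>u\<close> outside the last column cancel in the summand, and what remains is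
  a Kloosterman-type sum over \<open>z\<^sub>0, \<dots>, z\<^bsub>m-1\<^esub>\<close> with \<open>z\<^sub>m = a\<close>. The summand is a product over
  consecutive pairs \<open>(z\<^sub>k, z\<^bsub>k+1\<^esub>)\<close>, so fixing \<open>t = z\<^bsub>m-1\<^esub>\<close> gives the recursion; the constant is the
  quotient of the values of \<open>|B\<^sub>n| |U\<^bsub>n-1\<^esub>| / |G\<^sub>n|\<close> at \<open>n\<close> and \<open>n - 1\<close>.
\<close>

subsection \<open>Orders of the groups\<close>

lemma mem_GL_iff: "g \<in> GL m \<longleftrightarrow> g \<in> carrier_mat m m \<and> det g \<noteq> 0"
  by (auto simp: GL_def invertible_mat_det_iff)

lemma prod_list_diag_mat:
  assumes "A \<in> carrier_mat m m"
  shows "prod_list (diag_mat A) = (\<Prod>i<m. A $$ (i, i))"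
  using assms by (simp add: diag_mat_def prod.list_conv_set_nth atLeast0LessThan)

text \<open>The determinant of a triangular matrix is the product of its diagonal, so invertibility
  turns into nonvanishing diagonal entries and membership can be checked entry by entry.\<close>

lemma mem_lower_borel_iff:
  "b \<in> lower_borel m \<longleftrightarrow> b \<in> carrier_mat m m \<and>
     (\<forall>i<m. \<forall>j<m. i < j \<longrightarrow> b $$ (i, j) = 0) \<and> (\<forall>i<m. b $$ (i, i) \<noteq> 0)"
proof
  assume "b \<in> lower_borel m"
  then show "b \<in> carrier_mat m m \<and> (\<forall>i<m. \<forall>j<m. i < j \<longrightarrow> b $$ (i, j) = 0) \<and> (\<forall>i<m. b $$ (i, i) \<noteq> 0)"
    using lower_borel_diag_nonzero by (auto simp: lower_borel_def GL_def)
next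
  assume *: "b \<in> carrier_mat m m \<and> (\<forall>i<m. \<forall>j<m. i < j \<longrightarrow> b $$ (i, j) = 0) \<and> (\<forall>i<m. b $$ (i, i) \<noteq> 0)"
  then have "det b = prod_list (diag_mat b)"
    by (intro det_lower_triangular[of m]) auto
  with * show "b \<in> lower_borel m"
    by (auto simp: lower_borel_def mem_GL_iff prod_list_diag_mat[of _ m])
qed

lemma mem_upper_unipotent_iff:
  "u \<in> upper_unipotent m \<longleftrightarrow> u \<in> carrier_mat m m \<and>
     (\<forall>i<m. \<forall>j<i. u $$ (i, j) = 0) \<and> (\<forall>i<m. u $$ (i, i) = 1)"
proof
  assume "u \<in> upper_unipotent m"
  then show "u \<in> carrier_mat m m \<and> (\<forall>i<m. \<forall>j<i. u $$ (i, j) = 0) \<and> (\<forall>i<m. u $$ (i, i) = 1)"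
    by (auto simp: upper_unipotent_def GL_def)
next
  assume *: "u \<in> carrier_mat m m \<and> (\<forall>i<m. \<forall>j<i. u $$ (i, j) = 0) \<and> (\<forall>i<m. u $$ (i, i) = 1)"
  then have ut: "upper_triangular u" by auto
  then have "det u = 1"
    using * det_upper_triangular[OF ut, of m] prod_list_diag_mat[of u m] by simp
  with * ut show "u \<in> upper_unipotent m"
    by (auto simp: upper_unipotent_def mem_GL_iff)
qed

lemma lower_borel_subset_GL: "lower_borel m \<subseteq> GL m"
  by (auto simp: lower_borel_def)

lemma upper_unipotent_subset_GL: "upper_unipotent m \<subseteq> GL m"
  by (auto simp: upper_unipotent_def)

lemma one_mat_in_GL: "1\<^sub>m m \<in> GL m"
  by (simp add: mem_GL_iff)

lemma one_mat_in_lower_borel: "1\<^sub>m m \<in> lower_borel m"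
  by (simp add: mem_lower_borel_iff)

lemma card_GL_pos: "card (GL m :: 'a::{field,finite} mat set) > 0"
  using finite_GL one_mat_in_GL by (auto simp: card_gt_0_iff)

section \<open>Bordered matrices and the order of the lower Borel subgroup\<close>

definition row_bordered :: "nat \<Rightarrow> 'a::zero mat \<Rightarrow> (nat \<Rightarrow> 'a) \<Rightarrow> 'a \<Rightarrow> 'a mat" where
  "row_bordered n h w d = mat (Suc n) (Suc n)
     (\<lambda>(i, j). if i < n then (if j < n then h $$ (i, j) else 0) else if j < n then w j else d)"

lemma row_bordered_carrier [simp]: "row_bordered n h w d \<in> carrier_mat (Suc n) (Suc n)"
  by (simp add: row_bordered_def)

lemma row_bordered_index:
  assumes "i < Suc n" "j < Suc n"
  shows "row_bordered n h w d $$ (i, j) =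
    (if i < n then (if j < n then h $$ (i, j) else 0) else if j < n then w j else d)"
  using assms by (simp add: row_bordered_def)

lemma det_row_bordered:
  fixes h :: "'a::idom mat"
  assumes h: "h \<in> carrier_mat n n"
  shows "det (row_bordered n h w d) = det h * d"
proof -
  have "row_bordered n h w d =
      four_block_mat h (0\<^sub>m n 1) (mat 1 n (\<lambda>(i, j). w j)) (mat 1 1 (\<lambda>_. d))"
    using h by (intro eq_matI) (auto simp: row_bordered_def)
  also have "det \<dots> = det h * det (mat 1 1 (\<lambda>_. d))"
    using h by (intro det_four_block_mat_upper_right_zero) auto
  also have "det (mat 1 1 (\<lambda>_. d)) = d"
    by (simp add: det_single)
  finally show ?thesis .
qed

text \<open>The blocks can be read off the bordered matrix, so the parametrisation is injective;
  taking \<open>w\<close> from the extensional functions on \<open>{..<n}\<close> gives each bottom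
  row exactly one parameter. The lemma serves both the Borel subgroup and the invertible matrices
  whose last column is the last unit vector.\<close>

lemma card_row_bordered:
  fixes S :: "'a::{zero,finite} mat set"
  assumes S: "S \<subseteq> carrier_mat n n"
  shows "card ((\<lambda>(h, w, d). row_bordered n h w d) ` (S \<times> ({..<n} \<rightarrow>\<^sub>E UNIV) \<times> D))
    = card S * CARD('a) ^ n * card D"
proof -
  have "inj_on (\<lambda>(h, w, d). row_bordered n h w d) (S \<times> ({..<n} \<rightarrow>\<^sub>E UNIV) \<times> D)"
  proof (rule inj_onI)
    fix x y assume xy: "x \<in> S \<times> ({..<n} \<rightarrow>\<^sub>E UNIV) \<times> D" "y \<in> S \<times> ({..<n} \<rightarrow>\<^sub>E UNIV) \<times> D"
      "(\<lambda>(h, w, d). row_bordered n h w d) x = (\<lambda>(h, w, d). row_bordered n h w d) y"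
    obtain h w d h' w' d' where x: "x = (h, w, d)" and y: "y = (h', w', d')"
      by (cases x, cases y)
    have h: "h \<in> S" "h' \<in> S" and w: "w \<in> {..<n} \<rightarrow>\<^sub>E UNIV" "w' \<in> {..<n} \<rightarrow>\<^sub>E UNIV"
      and eq: "row_bordered n h w d = row_bordered n h' w' d'"
      using xy unfolding x y by auto
    have e: "row_bordered n h w d $$ (i, j) = row_bordered n h' w' d' $$ (i, j)" for i j
      using eq by simp
    have "h = h'"
    proof (rule eq_matI)
      fix i j assume "i < dim_row h'" "j < dim_col h'"
      then show "h $$ (i, j) = h' $$ (i, j)"
        using e[of i j] h S by (auto simp: row_bordered_index)
    qed (use h S in auto)
    moreover have "w = w'"
    proof (rule PiE_ext[OF w])
      fix j assume "j \<in> {..<n}"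
      then show "w j = w' j" using e[of n j] by (simp add: row_bordered_index)
    qed
    moreover have "d = d'" using e[of n n] by (simp add: row_bordered_index)
    ultimately show "x = y" by (simp add: x y)
  qed
  then show ?thesis
    by (simp add: card_image card_cartesian_product card_PiE)
qed

lemma lower_borel_Suc:
  "(lower_borel (Suc n) :: 'a::field mat set) =
     (\<lambda>(h, w, d). row_bordered n h w d) ` (lower_borel n \<times> ({..<n} \<rightarrow>\<^sub>E UNIV) \<times> (UNIV - {0}))"
  (is "_ = ?R")
proof
  show "lower_borel (Suc n) \<subseteq> ?R"
  proof
    fix b :: "'a mat" assume b: "b \<in> lower_borel (Suc n)"
    let ?h = "mat n n (\<lambda>(i, j). b $$ (i, j))"
    let ?w = "\<lambda>j\<in>{..<n}. b $$ (n, j)"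
    have "b = row_bordered n ?h ?w (b $$ (n, n))"
      using b by (intro eq_matI) (auto simp: row_bordered_def mem_lower_borel_iff less_Suc_eq)
    moreover have "?h \<in> lower_borel n" "b $$ (n, n) \<noteq> 0"
      using b by (auto simp: mem_lower_borel_iff)
    ultimately show "b \<in> ?R"
      by (intro image_eqI[where x = "(?h, ?w, b $$ (n, n))"]) auto
  qed
  have "row_bordered n h w d \<in> lower_borel (Suc n)" if "h \<in> lower_borel n" "d \<noteq> 0" for h w and d :: 'a
    using that by (simp add: mem_lower_borel_iff row_bordered_index)
  then show "?R \<subseteq> lower_borel (Suc n)" by (intro image_subsetI) (simp add: case_prod_unfold mem_Times_iff)
qed

lemma card_lower_borel_Suc:
  "card (lower_borel (Suc n) :: 'a::{field,finite} mat set) =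
     card (lower_borel n :: 'a mat set) * CARD('a) ^ n * (CARD('a) - 1)"
proof -
  have "lower_borel n \<subseteq> (carrier_mat n n :: 'a mat set)"
    by (simp add: mem_lower_borel_iff subset_iff)
  then show ?thesis
    unfolding lower_borel_Suc[of n, where 'a = 'a] by (simp add: card_row_bordered card_Diff_singleton)
qed

section \<open>The order of the general linear group, counted by last columns\<close>

definition GL_last_col :: "nat \<Rightarrow> (nat \<Rightarrow> 'a::field) \<Rightarrow> 'a mat set" where
  "GL_last_col n v = {g \<in> GL (Suc n). \<forall>i<Suc n. g $$ (i, n) = v i}"

text \<open>With a one in the corner and zeros above it, the determinant is that of the upper left
  block, while the rest of the bottom row is free.\<close>

lemma GL_last_col_unit:
  "(GL_last_col n (\<lambda>i. if i = n then 1 else 0) :: 'a::field mat set) =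
     (\<lambda>(h, w, d). row_bordered n h w d) ` (GL n \<times> ({..<n} \<rightarrow>\<^sub>E UNIV) \<times> {1})"
  (is "?L = ?R")
proof
  show "?L \<subseteq> ?R"
  proof
    fix b :: "'a mat" assume b: "b \<in> ?L"
    let ?h = "mat n n (\<lambda>(i, j). b $$ (i, j))"
    let ?w = "\<lambda>j\<in>{..<n}. b $$ (n, j)"
    have eq: "b = row_bordered n ?h ?w 1"
      using b by (intro eq_matI) (auto simp: row_bordered_def GL_last_col_def mem_GL_iff less_Suc_eq)
    have "det b = det ?h"
      by (subst eq) (simp add: det_row_bordered)
    then have "?h \<in> GL n"
      using b by (auto simp: GL_last_col_def mem_GL_iff)
    with eq show "b \<in> ?R"
      by (intro image_eqI[where x = "(?h, ?w, 1)"]) auto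
  qed
  have "row_bordered n h w 1 \<in> ?L" if "h \<in> GL n" for h :: "'a mat" and w
    using that by (simp add: GL_last_col_def mem_GL_iff det_row_bordered row_bordered_index)
  then show "?R \<subseteq> ?L" by (intro image_subsetI) (simp add: case_prod_unfold mem_Times_iff)
qed

lemma GL_last_col_nonempty:
  fixes v :: "nat \<Rightarrow> 'a::field"
  assumes "k \<le> n" "v k \<noteq> 0"
  obtains A where "A \<in> GL_last_col n v"
proof (cases "v n = 0")
  case False
  let ?A = "mat (Suc n) (Suc n) (\<lambda>(i, j). if j = n then v i else if i = j then 1 else 0)"
  \<comment> \<open>The identity matrix with its last column replaced by \<open>v\<close> is
    triangular with corner \<open>v n\<close>.\<close>
  have "det ?A = prod_list (diag_mat ?A)"
    by (intro det_upper_triangular[of _ "Suc n"]) (auto simp: upper_triangular_def)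
  also have "\<dots> \<noteq> 0"
    using False by (subst prod_list_diag_mat[of _ "Suc n"]) (auto simp: prod_zero_iff simp del: prod.lessThan_Suc)
  finally show ?thesis
    by (intro that[of ?A]) (auto simp: GL_last_col_def mem_GL_iff)
next
  case True
  with assms have k: "k < n" by (metis le_neq_implies_less)
  \<comment> \<open>The corner \<open>v n\<close> is zero here, so the nonzero \<open>v k\<close> is
    put there first. Subtracting row \<open>k\<close> from row \<open>n\<close> then restores the
    zero in the corner and keeps the determinant.\<close>
  let ?B = "mat (Suc n) (Suc n)
    (\<lambda>(i, j). if j = n then (if i = n then v k else v i) else if i = j then 1 else 0)"
  have "det ?B = prod_list (diag_mat ?B)"
    by (intro det_upper_triangular[of _ "Suc n"]) (auto simp: upper_triangular_def)
  also have "\<dots> \<noteq> 0"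
    using assms by (subst prod_list_diag_mat[of _ "Suc n"]) (auto simp: prod_zero_iff simp del: prod.lessThan_Suc)
  finally have "det (addrow (-1) n k ?B) \<noteq> 0"
    using k by (subst det_addrow[where n = "Suc n"]) auto
  then show ?thesis
    using k True by (intro that[of "addrow (-1) n k ?B"]) (auto simp: GL_last_col_def mem_GL_iff)
qed

lemma GL_inverse:
  assumes "A \<in> GL m"
  obtains B where "B \<in> GL m" "A * B = 1\<^sub>m m" "B * A = 1\<^sub>m m"
proof -
  have A: "A \<in> carrier_mat m m" "det A \<noteq> 0" using assms by (auto simp: mem_GL_iff)
  from det_non_zero_imp_unit[OF this, of undefined]
  obtain B where B: "B \<in> carrier_mat m m" "A * B = 1\<^sub>m m" "B * A = 1\<^sub>m m"
    unfolding Units_def by (auto simp: ring_mat_def)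
  have "det A * det B = 1" using det_mult[OF A(1) B(1)] B(2) by simp
  then have "B \<in> GL m" using B by (auto simp: mem_GL_iff)
  with B that show ?thesis by blast
qed

lemma mult_unit_last_col:
  fixes A :: "'a::semiring_1 mat"
  assumes "A \<in> carrier_mat (Suc n) (Suc n)" "g \<in> carrier_mat (Suc n) (Suc n)" "i < Suc n"
    and "\<And>l. l < Suc n \<Longrightarrow> g $$ (l, n) = (if l = n then 1 else 0)"
  shows "(A * g) $$ (i, n) = A $$ (i, n)"
proof -
  have "(A * g) $$ (i, n) = (\<Sum>l<Suc n. A $$ (i, l) * g $$ (l, n))"
    using assms(1-3) by (simp add: scalar_prod_def atLeast0LessThan del: sum.lessThan_Suc)
  also have "\<dots> = (\<Sum>l<Suc n. if l = n then A $$ (i, l) else 0)"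
    using assms(4) by (intro sum.cong) auto
  finally show ?thesis by simp
qed

text \<open>Left multiplication by one fixed invertible matrix with last column \<open>v\<close>
  carries the matrices with last unit column bijectively to those with last column \<open>v\<close>.
  Hence the count does not depend on the nonzero vector \<open>v\<close>.\<close>

lemma card_GL_last_col:
  fixes v :: "nat \<Rightarrow> 'a::{field,finite}"
  assumes "k \<le> n" "v k \<noteq> 0"
  shows "card (GL_last_col n v) = card (GL n :: 'a mat set) * CARD('a) ^ n"
proof -
  define e where "e = (\<lambda>i. if i = n then 1 else 0 :: 'a)"
  obtain A where A: "A \<in> GL_last_col n v" using GL_last_col_nonempty[of k n v] assms by blast
  then have AG: "A \<in> GL (Suc n)" by (simp add: GL_last_col_def)
  obtain B where B: "B \<in> GL (Suc n)" "A * B = 1\<^sub>m (Suc n)" "B * A = 1\<^sub>m (Suc n)"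
    using GL_inverse[OF AG] .
  have car: "A \<in> carrier_mat (Suc n) (Suc n)" "B \<in> carrier_mat (Suc n) (Suc n)"
    using AG B by (auto simp: mem_GL_iff)
  \<comment> \<open>The last column of a product depends only on the last column of the right
    factor, which \<open>g\<close> shares with \<open>A\<close>; and \<open>B * A\<close> is the
    identity.\<close>
  have BAv: "(B * g) $$ (i, n) = e i" if "g \<in> GL_last_col n v" "i < Suc n" for g i
  proof -
    have g: "g \<in> carrier_mat (Suc n) (Suc n)" using that by (simp add: GL_last_col_def mem_GL_iff)
    have "col g n = col A n"
      using that g car A by (intro eq_vecI) (auto simp: GL_last_col_def)
    then have "(B * g) $$ (i, n) = (B * A) $$ (i, n)"
      using that g car by simp
    then show ?thesis using that B by (simp add: e_def)
  qed
  have "bij_betw ((*) A) (GL_last_col n e) (GL_last_col n v)"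
  proof (rule bij_betw_byWitness[where f' = "(*) B"])
    show "\<forall>g\<in>GL_last_col n e. B * (A * g) = g"
    proof
      fix g assume "g \<in> GL_last_col n e"
      then have g: "g \<in> carrier_mat (Suc n) (Suc n)" by (simp add: GL_last_col_def mem_GL_iff)
      then show "B * (A * g) = g"
        using car B(3) by (metis assoc_mult_mat left_mult_one_mat)
    qed
    show "\<forall>g\<in>GL_last_col n v. A * (B * g) = g"
    proof
      fix g assume "g \<in> GL_last_col n v"
      then have g: "g \<in> carrier_mat (Suc n) (Suc n)" by (simp add: GL_last_col_def mem_GL_iff)
      then show "A * (B * g) = g"
        using car B(2) by (metis assoc_mult_mat left_mult_one_mat)
    qed
    show "(*) A ` GL_last_col n e \<subseteq> GL_last_col n v"
    proof clarify
      fix g assume g: "g \<in> GL_last_col n e"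
      then have "A * g \<in> GL (Suc n)" using AG GL_mult by (auto simp: GL_last_col_def)
      moreover have "(A * g) $$ (i, n) = v i" if "i < Suc n" for i
        using that g A car by (subst mult_unit_last_col) (auto simp: GL_last_col_def e_def mem_GL_iff)
      ultimately show "A * g \<in> GL_last_col n v" by (simp add: GL_last_col_def)
    qed
    show "(*) B ` GL_last_col n v \<subseteq> GL_last_col n e"
      using B(1) GL_mult BAv by (auto simp: GL_last_col_def)
  qed
  then have "card (GL_last_col n v) = card (GL_last_col n e)"
    by (simp add: bij_betw_same_card)
  also have "\<dots> = card (GL n :: 'a mat set) * CARD('a) ^ n"
  proof -
    have "GL n \<subseteq> (carrier_mat n n :: 'a mat set)"
      by (simp add: mem_GL_iff subset_iff)
    then show ?thesis
      unfolding e_def GL_last_col_unit by (simp add: card_row_bordered)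
  qed
  finally show ?thesis .
qed

text \<open>The last column of an invertible matrix is one of the
  \<open>CARD('a) ^ Suc n - 1\<close> nonzero vectors, and each of these occurs equally
  often.\<close>

lemma card_GL_Suc:
  "card (GL (Suc n) :: 'a::{field,finite} mat set) =
     (CARD('a) ^ Suc n - 1) * (card (GL n :: 'a mat set) * CARD('a) ^ n)"
proof -
  define z where "z = (\<lambda>i\<in>{..<Suc n}. 0 :: 'a)"
  define V where "V = ({..<Suc n} \<rightarrow>\<^sub>E (UNIV :: 'a set)) - {z}"
  have nz: "\<exists>k\<le>n. v k \<noteq> 0" if "v \<in> V" for v
  proof (rule ccontr)
    assume "\<not> ?thesis"
    then have "v = z"
      using that unfolding V_def z_def by (intro PiE_ext[of v "{..<Suc n}" "\<lambda>_. UNIV"]) auto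
    then show False using that by (simp add: V_def)
  qed
  have "GL (Suc n) = (\<Union>v\<in>V. GL_last_col n v)" (is "?G = ?U")
  proof
    show "?G \<subseteq> ?U"
    proof
      fix g :: "'a mat" assume g: "g \<in> GL (Suc n)"
      let ?v = "\<lambda>i\<in>{..<Suc n}. g $$ (i, n)"
      have "?v \<noteq> z"
      proof
        assume "?v = z"
        then have 0: "g $$ (i, n) = 0" if "i < Suc n" for i
          using that unfolding z_def by (metis lessThan_iff restrict_apply')
        obtain B where B: "B \<in> GL (Suc n)" "B * g = 1\<^sub>m (Suc n)" using GL_inverse[OF g] by blast
        have "B \<in> carrier_mat (Suc n) (Suc n)" "g \<in> carrier_mat (Suc n) (Suc n)"
          using B(1) g by (auto simp: mem_GL_iff)
        then have "(B * g) $$ (n, n) = 0"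
          using 0 by (auto simp: scalar_prod_def intro!: sum.neutral)
        with B(2) show False by simp
      qed
      then have "?v \<in> V" by (simp add: V_def)
      moreover have "g \<in> GL_last_col n ?v" using g by (simp add: GL_last_col_def)
      ultimately show "g \<in> ?U" by blast
    qed
  qed (auto simp: GL_last_col_def)
  also have "card \<dots> = (\<Sum>v\<in>V. card (GL_last_col n v))"
  proof (rule card_UN_disjoint)
    show "finite V" by (simp add: V_def finite_PiE)
    show "\<forall>v\<in>V. finite (GL_last_col n v)"
      by (auto simp: GL_last_col_def intro: finite_subset[OF _ finite_GL])
    show "\<forall>v\<in>V. \<forall>w\<in>V. v \<noteq> w \<longrightarrow> GL_last_col n v \<inter> GL_last_col n w = {}"
    proof (intro ballI impI, rule ccontr)
      fix v w assume vw: "v \<in> V" "w \<in> V" "v \<noteq> w" "GL_last_col n v \<inter> GL_last_col n w \<noteq> {}"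
      then have "v i = w i" if "i < Suc n" for i
        using that by (auto simp: GL_last_col_def)
      then have "v = w"
        using vw unfolding V_def
        by (intro PiE_ext[of v "{..<Suc n}" "\<lambda>_. UNIV" w]) auto
      with vw show False by simp
    qed
  qed
  also have "\<dots> = (\<Sum>v\<in>V. card (GL n :: 'a mat set) * CARD('a) ^ n)"
    using nz card_GL_last_col by (intro sum.cong) blast+
  also have "\<dots> = (CARD('a) ^ Suc n - 1) * (card (GL n :: 'a mat set) * CARD('a) ^ n)"
  proof -
    have "card V = CARD('a) ^ Suc n - 1"
      unfolding V_def by (subst card_Diff_singleton) (auto simp: z_def card_PiE simp del: power_Suc)
    then show ?thesis by simp
  qed
  finally show ?thesis .
qed

subsection \<open>Characters and the sum over the unipotent group\<close>

text \<open>Permuting the factors leaves the product of all values of \<open>f\<close> unchanged but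
  multiplies it by \<open>w ^ card S\<close>, so \<open>w\<close> is a root of unity. This yields
  unitarity of additive and multiplicative characters alike.\<close>

lemma norm_eq_1_if_translates:
  fixes f :: "'b \<Rightarrow> 'c::{real_normed_field}"
  assumes "finite S" "S \<noteq> {}" "bij_betw t S S"
    and "\<And>y. y \<in> S \<Longrightarrow> f y \<noteq> 0" "\<And>y. y \<in> S \<Longrightarrow> f (t y) = w * f y"
  shows "norm w = 1"
proof -
  have "(\<Prod>y\<in>S. f y) = (\<Prod>y\<in>S. f (t y))"
    using prod.reindex_bij_betw[OF assms(3), of f] by simp
  also have "\<dots> = w ^ card S * (\<Prod>y\<in>S. f y)"
    using assms(5) by (simp add: prod.distrib)
  finally have "w ^ card S = 1"
    using assms(1,4) by (simp add: prod_zero_iff)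
  then have "norm w ^ card S = 1"
    by (metis norm_one norm_power)
  moreover have "card S > 0" using assms(1,2) by (simp add: card_gt_0_iff)
  ultimately show ?thesis
    using power_eq_imp_eq_base[of "norm w" "card S" 1] by simp
qed

lemma norm_additive_character:
  fixes \<psi> :: "'a::{field,finite} \<Rightarrow> complex"
  assumes "additive_character \<psi>"
  shows "norm (\<psi> x) = 1"
proof (rule norm_eq_1_if_translates[of UNIV "\<lambda>y. x + y" \<psi>])
  show "bij_betw ((+) x) UNIV UNIV"
    by (rule bij_betw_byWitness[where f' = "\<lambda>y. y - x"]) auto
qed (use assms in \<open>auto simp: additive_character_def\<close>)

lemma norm_multiplicative_character:
  fixes \<chi> :: "'a::{field,finite} \<Rightarrow> complex"
  assumes "multiplicative_character \<chi>" "x \<noteq> 0"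
  shows "norm (\<chi> x) = 1"
proof (rule norm_eq_1_if_translates[of "UNIV - {0}" "\<lambda>y. x * y" \<chi>])
  show "bij_betw ((*) x) (UNIV - {0}) (UNIV - {0})"
    using assms(2) by (intro bij_betw_byWitness[where f' = "\<lambda>y. y / x"]) auto
  show "UNIV - {0} \<noteq> ({} :: 'a set)" using assms(2) by blast
qed (use assms in \<open>auto simp: multiplicative_character_def\<close>)

lemma additive_character_0: "additive_character \<psi> \<Longrightarrow> \<psi> 0 = 1"
  unfolding additive_character_def by (metis add_0 mult_cancel_right1)

lemma multiplicative_character_1: "multiplicative_character \<chi> \<Longrightarrow> \<chi> 1 = 1"
  unfolding multiplicative_character_def by (metis mult_1 mult_cancel_right1 one_neq_zero)

lemma additive_character_sum:
  assumes "additive_character \<psi>"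
  shows "\<psi> (\<Sum>i\<in>S. f i) = (\<Prod>i\<in>S. \<psi> (f i))"
  using assms additive_character_0[OF assms]
  by (induction S rule: infinite_finite_induct) (auto simp: additive_character_def)

lemma cnj_additive_character:
  fixes \<psi> :: "'a::{field,finite} \<Rightarrow> complex"
  assumes "additive_character \<psi>"
  shows "cnj (\<psi> x) = \<psi> (- x)"
proof -
  have "\<psi> x * cnj (\<psi> x) = 1"
    using norm_additive_character[OF assms, of x] by (simp add: complex_norm_square[symmetric])
  moreover have "\<psi> x * \<psi> (- x) = 1"
    using assms additive_character_0[OF assms]
    by (metis additive_character_def add.right_inverse)
  ultimately show ?thesis
    by (metis mult_cancel_left mult_zero_left zero_neq_one)
qed

lemma norm_borel_char:
  fixes \<chi> :: "nat \<Rightarrow> 'a::{field,finite} \<Rightarrow> complex"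
  assumes "\<And>i. i \<in> {1..m} \<Longrightarrow> multiplicative_character (\<chi> i)" "b \<in> lower_borel m"
  shows "norm (borel_char m \<chi> b) = 1"
  unfolding borel_char_def prod_norm[symmetric]
  using assms lower_borel_diag_nonzero[OF assms(2)]
  by (intro prod.neutral ballI norm_multiplicative_character) auto

section \<open>Equivariance of the Whittaker vector and reduction to the unipotent group\<close>

lemma whittaker_vector_lower_borel_mult:
  assumes "\<And>i. i \<in> {1..m} \<Longrightarrow> multiplicative_character (\<chi> i)" "b \<in> lower_borel m" "g \<in> GL m"
  shows "whittaker_vector m \<chi> \<psi> (b * g) = borel_char m \<chi> b * whittaker_vector m \<chi> \<psi> g"
  using whittaker_vector_in_principal_series[OF assms(1)] assms(2,3)
  by (auto simp: principal_series_def)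

lemma whittaker_vector_unipotent:
  assumes "\<And>i. i \<in> {1..m} \<Longrightarrow> multiplicative_character (\<chi> i)" "u \<in> upper_unipotent m"
  shows "whittaker_vector m \<chi> \<psi> u = unipotent_char m \<psi> u"
proof -
  have "borel_char m \<chi> (1\<^sub>m m) = 1"
    using multiplicative_character_1[OF assms(1)] by (auto simp: borel_char_def intro!: prod.neutral)
  moreover have "1\<^sub>m m * u = u"
    using assms(2) by (intro left_mult_one_mat[of u m m]) (simp add: mem_upper_unipotent_iff)
  ultimately show ?thesis
    using whittaker_vector_mult[OF one_mat_in_lower_borel assms(2), of \<chi> \<psi>] by simp
qed

text \<open>The second factor of the inner product is supported on the big cell, where
  factorisations \<open>b * u\<close> are unique. The unitary character of \<open>b\<close> occurs
  once plain and once conjugated, so the summand does not depend on \<open>b\<close>, which only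
  contributes the order of the Borel subgroup.\<close>

lemma whittaker_function_eq_sum_unipotent:
  fixes \<chi> :: "nat \<Rightarrow> 'a::{field,finite} \<Rightarrow> complex"
  assumes \<chi>: "\<And>i. i \<in> {1..m} \<Longrightarrow> multiplicative_character (\<chi> i)" and h: "h \<in> GL m"
  shows "whittaker_function m \<chi> \<psi> h =
    of_nat (card (lower_borel m :: 'a mat set)) / of_nat (card (GL m :: 'a mat set)) *
    (\<Sum>u\<in>upper_unipotent m. whittaker_vector m \<chi> \<psi> (u * h) * cnj (unipotent_char m \<psi> u))"
proof -
  let ?W = "whittaker_vector m \<chi> \<psi>"
  let ?B = "lower_borel m :: 'a mat set" and ?U = "upper_unipotent m :: 'a mat set"
  have inj: "inj_on (\<lambda>(b, u). b * u) (?B \<times> ?U)"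
    using borel_unipotent_unique by (fastforce intro!: inj_onI)
  have sub: "(\<lambda>(b, u). b * u) ` (?B \<times> ?U) \<subseteq> GL m"
  proof (intro image_subsetI)
    fix x assume "x \<in> ?B \<times> ?U"
    then have "fst x * snd x \<in> GL m"
      using lower_borel_subset_GL upper_unipotent_subset_GL
      by (intro GL_mult) (auto simp: mem_Times_iff)
    then show "(\<lambda>(b, u). b * u) x \<in> GL m" by (simp add: case_prod_unfold)
  qed
  have "(\<Sum>g\<in>GL m. ?W (g * h) * cnj (?W g)) =
      (\<Sum>g\<in>(\<lambda>(b, u). b * u) ` (?B \<times> ?U). ?W (g * h) * cnj (?W g))"
    using sub by (intro sum.mono_neutral_right finite_GL) (auto simp: whittaker_vector_def)
  also have "\<dots> = (\<Sum>(b, u)\<in>?B \<times> ?U. ?W (b * u * h) * cnj (?W (b * u)))"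
    by (subst sum.reindex[OF inj]) (simp add: case_prod_unfold)
  also have "\<dots> = (\<Sum>(b, u)\<in>?B \<times> ?U. ?W (u * h) * cnj (unipotent_char m \<psi> u))"
  proof (intro sum.cong refl, clarify)
    fix b u assume b: "b \<in> ?B" and u: "u \<in> ?U"
    have bG: "b \<in> GL m" and uG: "u \<in> GL m"
      using b u lower_borel_subset_GL upper_unipotent_subset_GL by blast+
    have "b * u * h = b * (u * h)"
      using bG uG h by (intro assoc_mult_mat) (auto simp: mem_GL_iff)
    then have 1: "?W (b * u * h) = borel_char m \<chi> b * ?W (u * h)"
      using whittaker_vector_lower_borel_mult[OF \<chi> b GL_mult[OF uG h]] by simp
    have "borel_char m \<chi> b * cnj (borel_char m \<chi> b) = 1"
      using norm_borel_char[OF \<chi> b] by (simp add: complex_norm_square[symmetric])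
    then have "borel_char m \<chi> b * x * (cnj (borel_char m \<chi> b) * y) = x * y" for x y
      by (simp add: mult.assoc mult.left_commute[of x])
    then show "?W (b * u * h) * cnj (?W (b * u)) = ?W (u * h) * cnj (unipotent_char m \<psi> u)"
      unfolding 1 whittaker_vector_mult[OF b u] complex_cnj_mult by blast
  qed
  also have "\<dots> = of_nat (card ?B) * (\<Sum>u\<in>?U. ?W (u * h) * cnj (unipotent_char m \<psi> u))"
    by (subst sum.cartesian_product[symmetric]) simp
  finally show ?thesis
    by (simp add: whittaker_function_def GL_inner_def right_translation_def)
qed

section \<open>The antidiagonal element\<close>

lemma antidiag_block_carrier [simp]:
  "antidiag_block (Suc m) c1 c2 \<in> carrier_mat (Suc m) (Suc m)"
  by (rule carrier_matI) (simp_all add: antidiag_block_def)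

lemma antidiag_block_index:
  assumes "i < Suc m" "j < Suc m"
  shows "antidiag_block (Suc m) c1 c2 $$ (i, j) =
    (if j = 0 then (if i = m then c2 else 0) else if i = j - 1 then c1 else 0)"
  using assms by (auto simp: antidiag_block_def)

text \<open>Right multiplication shifts the columns cyclically: the last one comes first, scaled by
  \<open>c2\<close>, and the others move one place to the right, scaled by
  \<open>c1\<close>.\<close>

lemma mult_antidiag_block_index:
  assumes u: "u \<in> carrier_mat (Suc m) (Suc m)" and ij: "i < Suc m" "j < Suc m"
  shows "(u * antidiag_block (Suc m) c1 c2) $$ (i, j) =
    (if j = 0 then u $$ (i, m) * c2 else u $$ (i, j - 1) * c1)"
proof -
  have "(u * antidiag_block (Suc m) c1 c2) $$ (i, j) =
      (\<Sum>l\<in>{..<Suc m}. u $$ (i, l) * antidiag_block (Suc m) c1 c2 $$ (l, j))"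
    using u ij antidiag_block_carrier[of m c1 c2]
    by (simp add: scalar_prod_def atLeast0LessThan carrier_matD del: sum.lessThan_Suc antidiag_block_carrier)
  also have "\<dots> = (\<Sum>l\<in>{..<Suc m}. if l = (if j = 0 then m else j - 1)
      then u $$ (i, l) * (if j = 0 then c2 else c1) else 0)"
    using ij by (intro sum.cong) (auto simp: antidiag_block_index)
  also have "\<dots> = (if j = 0 then u $$ (i, m) * c2 else u $$ (i, j - 1) * c1)"
    using ij by (subst sum.delta) auto
  finally show ?thesis .
qed

lemma antidiag_block_in_GL:
  assumes "c1 \<noteq> 0" "c2 \<noteq> 0"
  shows "antidiag_block (Suc m) c1 c2 \<in> GL (Suc m)"
proof -
  define h where "h = mat (Suc m) (Suc m)
    (\<lambda>(i, j). if i = 0 then (if j = m then 1 / c2 else 0) else if i = Suc j then 1 / c1 else 0)"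
  have h: "h \<in> carrier_mat (Suc m) (Suc m)" by (simp add: h_def)
  have "h * antidiag_block (Suc m) c1 c2 = 1\<^sub>m (Suc m)"
  proof (rule eq_matI)
    fix i j assume "i < dim_row (1\<^sub>m (Suc m) :: 'a mat)" "j < dim_col (1\<^sub>m (Suc m) :: 'a mat)"
    then have ij: "i < Suc m" "j < Suc m" by auto
    show "(h * antidiag_block (Suc m) c1 c2) $$ (i, j) = 1\<^sub>m (Suc m) $$ (i, j)"
      unfolding mult_antidiag_block_index[OF h ij] using ij assms by (auto simp: h_def)
  qed (use h carrier_matD[OF antidiag_block_carrier] in auto)
  then have "det h * det (antidiag_block (Suc m) c1 c2) = 1"
    using det_mult[OF h antidiag_block_carrier[of m c1 c2]] by simp
  then show ?thesis by (auto simp: mem_GL_iff)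
qed

subsection \<open>The Whittaker vector at antidiagonal translates\<close>

text \<open>The characters \<chi> are evaluated at the inverse diagonal entries of the bidiagonal
  matrix that makes the translate unipotent. As tuples start at 1 and matrices at 0, diagonal entry
  \<open>Suc k\<close> belongs to \<open>\<chi> (Suc (Suc k))\<close>.\<close>

definition whittaker_summand ::
  "nat \<Rightarrow> (nat \<Rightarrow> 'a::field \<Rightarrow> complex) \<Rightarrow> ('a \<Rightarrow> complex) \<Rightarrow> (nat \<Rightarrow> 'a) \<Rightarrow> complex" where
  "whittaker_summand m \<chi> \<psi> z = \<chi> 1 (z 0) * \<psi> (1 / z 0) *
     (\<Prod>k<m. \<chi> (Suc (Suc k)) (- (z (Suc k) / z k)) * \<psi> (- (z k / z (Suc k))))"

text \<open>If the translate were in the big cell, a zero in the last column of \<open>u\<close>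
  would force a zero just below it, and so on down to the diagonal entry, which is 1.\<close>

lemma whittaker_vector_antidiag_eq_0:
  assumes u: "u \<in> upper_unipotent (Suc m)" and a: "a \<noteq> 0"
    and zero: "k \<le> m" "u $$ (k, m) = 0"
  shows "whittaker_vector (Suc m) \<chi> \<psi> (u * antidiag_block (Suc m) 1 a) = 0"
proof (rule ccontr)
  let ?M = "u * antidiag_block (Suc m) 1 a"
  assume "\<not> ?thesis"
  then have "\<exists>b\<in>lower_borel (Suc m). \<exists>v\<in>upper_unipotent (Suc m). ?M = b * v"
    by (auto simp: whittaker_vector_def split: if_splits)
  then obtain b v where b: "b \<in> lower_borel (Suc m)" and v: "v \<in> upper_unipotent (Suc m)"
    and M: "?M = b * v" by blast
  obtain c where c: "c \<in> lower_borel (Suc m)" "c * b = 1\<^sub>m (Suc m)"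
    using lower_borel_inverse[OF b] .
  have uc: "u \<in> carrier_mat (Suc m) (Suc m)"
    and u0: "\<And>i j. j < i \<Longrightarrow> i < Suc m \<Longrightarrow> u $$ (i, j) = 0"
    and u1: "\<And>i. i < Suc m \<Longrightarrow> u $$ (i, i) = 1"
    using u by (auto simp: mem_upper_unipotent_iff)
  have Mc: "?M \<in> carrier_mat (Suc m) (Suc m)"
    using uc antidiag_block_carrier[of m 1 a] by (rule mult_carrier_mat)
  have "c * ?M = (c * b) * v"
    unfolding M using b c v
    by (intro assoc_mult_mat[symmetric, of _ "Suc m" "Suc m" _ "Suc m" _ "Suc m"])
       (auto simp: mem_lower_borel_iff mem_upper_unipotent_iff)
  also have "\<dots> = v"
    unfolding c(2) using v by (intro left_mult_one_mat[of _ _ "Suc m"]) (simp add: mem_upper_unipotent_iff)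
  finally have cM: "c * ?M = v" .
  have entry0: "v $$ (i, 0) = (\<Sum>l\<le>i. c $$ (i, l) * u $$ (l, m)) * a" if "i < Suc m" for i
    using lower_borel_mult_entry[OF c(1) Mc that, of 0] that
    by (simp add: cM mult_antidiag_block_index[OF uc] sum_distrib_right mult.assoc)
  \<comment> \<open>Column \<open>Suc j\<close> of the translate is column \<open>j\<close> of
    \<open>u\<close>; triangularity cuts the sum at \<open>j\<close>, and the last term has
    coefficient \<open>u $$ (j, j) = 1\<close>.\<close>
  have entry: "v $$ (i, Suc j) = (\<Sum>l<j. c $$ (i, l) * u $$ (l, j)) + c $$ (i, j)"
    if "i < Suc m" "j < m" "j \<le> i" for i j
  proof -
    have "v $$ (i, Suc j) = (\<Sum>l\<le>i. c $$ (i, l) * u $$ (l, j))"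
      using lower_borel_mult_entry[OF c(1) Mc that(1), of "Suc j"] that
      by (simp add: cM mult_antidiag_block_index[OF uc])
    also have "\<dots> = (\<Sum>l\<le>j. c $$ (i, l) * u $$ (l, j))"
      using that u0 by (intro sum.mono_neutral_right) auto
    finally show ?thesis
      using u1 that by (simp add: lessThan_Suc_atMost[symmetric])
  qed
  \<comment> \<open>The entry of \<open>v\<close> at \<open>(Suc k, Suc j)\<close> lies below the
    diagonal. Solving these equations from left to right leaves in row \<open>Suc k\<close> of
    \<open>c\<close> only the diagonal entry and its left neighbour.\<close>
  have c0: "c $$ (Suc k, j) = 0" if "k < m" "j < k" for k j
    using that(2)
  proof (induction j rule: less_induct)
    case (less j)
    have "v $$ (Suc k, Suc j) = 0"
      using v less.prems that by (simp add: mem_upper_unipotent_iff)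
    moreover have "(\<Sum>l<j. c $$ (Suc k, l) * u $$ (l, j)) = 0"
      using less by (intro sum.neutral) auto
    ultimately show ?case
      using entry[of "Suc k" j] less.prems that by simp
  qed
  have step: "u $$ (Suc k, m) = 0" if k: "k < m" "u $$ (k, m) = 0" for k
  proof -
    have "v $$ (Suc k, 0) = 0" using v k by (simp add: mem_upper_unipotent_iff)
    then have "(\<Sum>l\<le>Suc k. c $$ (Suc k, l) * u $$ (l, m)) = 0"
      using entry0[of "Suc k"] k a by simp
    moreover have "(\<Sum>l\<le>Suc k. c $$ (Suc k, l) * u $$ (l, m)) = c $$ (Suc k, Suc k) * u $$ (Suc k, m)"
    proof -
      have "(\<Sum>l\<le>k. c $$ (Suc k, l) * u $$ (l, m)) = 0"
        using c0[OF k(1)] k(2) by (intro sum.neutral) (auto simp: le_less)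
      then show ?thesis by simp
    qed
    ultimately show ?thesis
      using lower_borel_diag_nonzero[OF c(1), of "Suc k"] k by simp
  qed
  \<comment> \<open>The statement under induction is the implication from a zero in row
    \<open>k\<close> to a zero in row \<open>m\<close>; \<open>step\<close> reduces it from
    \<open>k\<close> to \<open>Suc k\<close>.\<close>
  have "u $$ (m, m) = 0"
    using zero
  proof (induction k rule: inc_induct)
    case (step k)
    then show ?case using \<open>\<And>k. k < m \<Longrightarrow> u $$ (k, m) = 0 \<Longrightarrow> u $$ (Suc k, m) = 0\<close> by blast
  qed
  then show False using u1[of m] by simp
qed

text \<open>An explicit lower triangular \<open>c\<close> moves the translate into the unipotent
  group. Equivariance then gives the value of the Whittaker vector, and the superdiagonal of
  \<open>u\<close> enters it with a character value that the conjugate factor cancels.\<close>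

lemma whittaker_vector_antidiag:
  fixes \<psi> :: "'a::{field,finite} \<Rightarrow> complex"
  assumes \<chi>: "\<And>i. i \<in> {1..Suc m} \<Longrightarrow> multiplicative_character (\<chi> i)"
    and \<psi>: "additive_character \<psi>" and m: "m \<ge> 1"
    and u: "u \<in> upper_unipotent (Suc m)" and a: "a \<noteq> 0"
    and z: "\<And>k. k \<le> m \<Longrightarrow> z k = a * u $$ (k, m)" "\<And>k. k \<le> m \<Longrightarrow> z k \<noteq> 0"
  shows "whittaker_vector (Suc m) \<chi> \<psi> (u * antidiag_block (Suc m) 1 a) *
      cnj (unipotent_char (Suc m) \<psi> u) = whittaker_summand m \<chi> \<psi> z"
proof -
  let ?M = "u * antidiag_block (Suc m) 1 a"
  \<comment> \<open>The values are forced by the first column \<open>z\<close> of the translate: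
    \<open>d 0 * z 0 = 1\<close>, and \<open>z k + d (Suc k) * z (Suc k) = 0\<close> in the later
    rows.\<close>
  define d where "d i = (if i = 0 then 1 / z 0 else - (z (i - 1) / z i))" for i
  define c where "c = mat (Suc m) (Suc m) (\<lambda>(i, j). if i = j then d i else if i = Suc j then 1 else 0)"
  have d0: "d i \<noteq> 0" if "i < Suc m" for i
    using that z(2) by (auto simp: d_def)
  have c: "c \<in> lower_borel (Suc m)"
    using d0 by (simp add: mem_lower_borel_iff c_def)
  have uc: "u \<in> carrier_mat (Suc m) (Suc m)"
    and u0: "\<And>i j. j < i \<Longrightarrow> i < Suc m \<Longrightarrow> u $$ (i, j) = 0"
    and u1: "\<And>i. i < Suc m \<Longrightarrow> u $$ (i, i) = 1"
    using u by (auto simp: mem_upper_unipotent_iff)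
  have MG: "?M \<in> GL (Suc m)"
    using u a upper_unipotent_subset_GL by (intro GL_mult antidiag_block_in_GL) auto
  then have Mc: "?M \<in> carrier_mat (Suc m) (Suc m)" by (simp add: mem_GL_iff)
  have M0: "?M $$ (i, 0) = z i" if "i < Suc m" for i
    using that z(1) by (simp add: mult_antidiag_block_index[OF uc])
  have MS: "?M $$ (i, Suc j) = u $$ (i, j)" if "i < Suc m" "j < m" for i j
    using that by (simp add: mult_antidiag_block_index[OF uc])
  have V0: "(c * ?M) $$ (0, j) = ?M $$ (0, j) / z 0" if "j < Suc m" for j
    using lower_borel_mult_entry[OF c Mc, of 0 j] that by (simp add: c_def d_def)
  have VS: "(c * ?M) $$ (Suc k, j) = ?M $$ (k, j) + d (Suc k) * ?M $$ (Suc k, j)"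
    if "k < m" "j < Suc m" for k j
  proof -
    have "(\<Sum>l<k. c $$ (Suc k, l) * ?M $$ (l, j)) = 0"
      using that by (intro sum.neutral) (auto simp: c_def)
    then show ?thesis
      using lower_borel_mult_entry[OF c Mc, of "Suc k" j] that
      by (simp add: c_def lessThan_Suc_atMost[symmetric])
  qed
  have V: "c * ?M \<in> upper_unipotent (Suc m)"
    unfolding mem_upper_unipotent_iff
  proof (intro conjI allI impI)
    show "c * ?M \<in> carrier_mat (Suc m) (Suc m)"
      by (rule mult_carrier_mat[OF _ Mc]) (simp add: c_def)
  next
    fix i j assume ij: "i < Suc m" "j < i"
    then obtain k where k: "i = Suc k" "k < m" by (cases i) auto
    show "(c * ?M) $$ (i, j) = 0"
    proof (cases j)
      case 0
      then show ?thesis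
        using k z(2)[of "Suc k"] by (simp add: VS M0 d_def)
    next
      case (Suc j')
      then show ?thesis
        using k ij by (simp add: VS MS u0)
    qed
  next
    fix i assume i: "i < Suc m"
    show "(c * ?M) $$ (i, i) = 1"
    proof (cases i)
      case 0
      then show ?thesis using z(2)[of 0] by (simp add: V0 M0)
    next
      case (Suc k)
      then show ?thesis using i by (simp add: VS MS u0 u1)
    qed
  qed
  \<comment> \<open>Row 0 of \<open>c\<close> has no subdiagonal entry, so the first superdiagonal
    entry of the product has its own form and is split off.\<close>
  obtain m' where m': "m = Suc m'" using m by (cases m) auto
  have "(\<Sum>i<m. (c * ?M) $$ (i, Suc i)) =
      1 / z 0 + (\<Sum>k<m'. (c * ?M) $$ (Suc k, Suc (Suc k)))"
  proof -
    have "(c * ?M) $$ (0, Suc 0) = 1 / z 0"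
      using m by (simp add: V0 MS u1)
    moreover have "(\<Sum>i<m. f i) = f 0 + (\<Sum>k<m'. f (Suc k))" for f :: "nat \<Rightarrow> 'a"
      by (simp only: m' sum.lessThan_Suc_shift)
    ultimately show ?thesis by simp
  qed
  also have "(\<Sum>k<m'. (c * ?M) $$ (Suc k, Suc (Suc k))) = (\<Sum>k<m'. u $$ (k, Suc k) - z k / z (Suc k))"
  proof (intro sum.cong refl)
    fix k assume "k \<in> {..<m'}"
    then have "Suc k < m" by (simp add: m')
    then show "(c * ?M) $$ (Suc k, Suc (Suc k)) = u $$ (k, Suc k) - z k / z (Suc k)"
      by (simp add: VS MS u1 d_def)
  qed
  \<comment> \<open>The range may grow from \<open>m'\<close> to \<open>m\<close>: the added
    difference at \<open>m'\<close> is zero, because \<open>z m = a\<close> and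
    \<open>z m' = a * u $$ (m', m)\<close>.\<close>
  also have "\<dots> = (\<Sum>k<m. u $$ (k, Suc k)) - (\<Sum>k<m. z k / z (Suc k))"
  proof -
    have "z m' / z m = u $$ (m', m)"
      using z(1)[of m'] z(1)[of m] a by (simp add: u1 m')
    then show ?thesis by (simp add: m' sum_subtractf)
  qed
  finally have eV: "unipotent_char (Suc m) \<psi> (c * ?M) =
      \<psi> (1 / z 0 + (\<Sum>k<m. u $$ (k, Suc k)) + (\<Sum>k<m. - (z k / z (Suc k))))"
    by (simp add: unipotent_char_def sum_negf add_diff_eq)
  define s where "s = (\<Sum>k<m. u $$ (k, Suc k))"
  have \<psi>add: "\<psi> (x + y) = \<psi> x * \<psi> y" for x y
    using \<psi> by (simp add: additive_character_def)
  have "\<psi> s * \<psi> (- s) = 1"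
    using \<psi>add[of s "- s"] additive_character_0[OF \<psi>] by simp
  then have eU: "unipotent_char (Suc m) \<psi> (c * ?M) * cnj (unipotent_char (Suc m) \<psi> u) =
      \<psi> (1 / z 0) * (\<Prod>k<m. \<psi> (- (z k / z (Suc k))))"
    unfolding eV s_def[symmetric] \<psi>add additive_character_sum[OF \<psi>]
    by (simp add: unipotent_char_def s_def[symmetric] cnj_additive_character[OF \<psi>])
  have "borel_char (Suc m) \<chi> c = (\<Prod>i<Suc m. \<chi> (Suc i) (d i))"
    unfolding borel_char_def One_nat_def prod.atLeast1_atMost_eq by (intro prod.cong) (auto simp: c_def)
  also have "\<dots> = \<chi> 1 (1 / z 0) * (\<Prod>k<m. \<chi> (Suc (Suc k)) (- (z k / z (Suc k))))"
    unfolding prod.lessThan_Suc_shift by (simp add: d_def)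
  finally have ec: "borel_char (Suc m) \<chi> c * (\<chi> 1 (z 0) * (\<Prod>k<m. \<chi> (Suc (Suc k)) (- (z (Suc k) / z k)))) =
      (\<chi> 1 (1 / z 0) * \<chi> 1 (z 0)) *
      (\<Prod>k<m. \<chi> (Suc (Suc k)) (- (z k / z (Suc k))) * \<chi> (Suc (Suc k)) (- (z (Suc k) / z k)))"
    by (simp add: prod.distrib)
  have inv: "\<chi> i x * \<chi> i y = 1" if "i \<in> {1..Suc m}" "x * y = 1" for i x y
  proof -
    have "x \<noteq> 0" "y \<noteq> 0" using that(2) by auto
    then have "\<chi> i (x * y) = \<chi> i x * \<chi> i y"
      using \<chi>[OF that(1)] unfolding multiplicative_character_def by blast
    then show ?thesis using that multiplicative_character_1[OF \<chi>[OF that(1)]] by simp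
  qed
  \<comment> \<open>The second factor is thus the inverse of the Borel character at
    \<open>c\<close>, so equivariance can be solved for the Whittaker vector.\<close>
  have ec1: "borel_char (Suc m) \<chi> c * (\<chi> 1 (z 0) * (\<Prod>k<m. \<chi> (Suc (Suc k)) (- (z (Suc k) / z k)))) = 1"
  proof -
    have "\<chi> 1 (1 / z 0) * \<chi> 1 (z 0) = 1"
      using z(2)[of 0] by (intro inv) auto
    moreover have "\<chi> (Suc (Suc k)) (- (z k / z (Suc k))) * \<chi> (Suc (Suc k)) (- (z (Suc k) / z k)) = 1"
      if "k < m" for k
      using that z(2)[of k] z(2)[of "Suc k"] by (intro inv) auto
    ultimately show ?thesis
      unfolding ec by simp
  qed
  have W: "borel_char (Suc m) \<chi> c * whittaker_vector (Suc m) \<chi> \<psi> ?M = unipotent_char (Suc m) \<psi> (c * ?M)"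
    using whittaker_vector_lower_borel_mult[OF \<chi> c MG, where \<psi> = \<psi>] whittaker_vector_unipotent[OF \<chi> V, where \<psi> = \<psi>] by simp
  let ?P = "\<chi> 1 (z 0) * (\<Prod>k<m. \<chi> (Suc (Suc k)) (- (z (Suc k) / z k)))"
  have "whittaker_vector (Suc m) \<chi> \<psi> ?M * cnj (unipotent_char (Suc m) \<psi> u) =
      (borel_char (Suc m) \<chi> c * ?P) *
      (whittaker_vector (Suc m) \<chi> \<psi> ?M * cnj (unipotent_char (Suc m) \<psi> u))"
    unfolding ec1 by simp
  also have "\<dots> = ?P * ((borel_char (Suc m) \<chi> c * whittaker_vector (Suc m) \<chi> \<psi> ?M) *
      cnj (unipotent_char (Suc m) \<psi> u))"
    by (simp only: mult_ac)
  also have "\<dots> = ?P * (\<psi> (1 / z 0) * (\<Prod>k<m. \<psi> (- (z k / z (Suc k)))))"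
    unfolding W eU ..
  also have "\<dots> = whittaker_summand m \<chi> \<psi> z"
    by (simp add: whittaker_summand_def prod.distrib mult_ac)
  finally show ?thesis .
qed

subsection \<open>The recursion\<close>

text \<open>A unipotent matrix consists of its upper left block and the free part of its last
  column. The summand sees only the latter, and scaling by the nonzero \<open>a\<close> permutes the
  possible columns.\<close>

lemma sum_upper_unipotent_Suc:
  fixes a :: "'a::{field,finite}"
  assumes a: "a \<noteq> 0"
  shows "(\<Sum>u\<in>upper_unipotent (Suc m). F (\<lambda>k\<in>{..<m}. a * u $$ (k, m))) =
    of_nat (card (upper_unipotent m :: 'a mat set)) * (\<Sum>y\<in>{..<m} \<rightarrow>\<^sub>E UNIV. F y :: 'c::comm_semiring_1)"
proof -
  let ?U = "upper_unipotent m :: 'a mat set"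
  let ?i = "\<lambda>x. mat (Suc m) (Suc m) (\<lambda>(i, j). if j < m then (if i < m then fst x $$ (i, j) else 0)
      else if i < m then snd x i / a else 1)"
  let ?j = "\<lambda>u. (mat m m (\<lambda>(i, j). u $$ (i, j)), \<lambda>k\<in>{..<m}. a * u $$ (k, m))"
  have "(\<Sum>u\<in>upper_unipotent (Suc m). F (\<lambda>k\<in>{..<m}. a * u $$ (k, m))) =
      (\<Sum>x\<in>?U \<times> ({..<m} \<rightarrow>\<^sub>E UNIV). F (snd x))"
  proof (rule sum.reindex_bij_witness[where i = ?i and j = ?j])
    fix u :: "'a mat" assume u: "u \<in> upper_unipotent (Suc m)"
    then show "?i (?j u) = u"
      using a by (intro eq_matI) (auto simp: mem_upper_unipotent_iff less_Suc_eq)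
    show "?j u \<in> ?U \<times> ({..<m} \<rightarrow>\<^sub>E UNIV)"
      using u by (auto simp: mem_upper_unipotent_iff)
    show "F (snd (?j u)) = F (\<lambda>k\<in>{..<m}. a * u $$ (k, m))" by simp
  next
    fix x :: "'a mat \<times> (nat \<Rightarrow> 'a)" assume x: "x \<in> ?U \<times> ({..<m} \<rightarrow>\<^sub>E UNIV)"
    have "mat m m (\<lambda>(i, j). ?i x $$ (i, j)) = fst x"
      using x by (intro eq_matI) (auto simp: mem_upper_unipotent_iff mem_Times_iff)
    moreover have "(\<lambda>k\<in>{..<m}. a * ?i x $$ (k, m)) = snd x"
      using x a by (intro PiE_ext[of _ "{..<m}" "\<lambda>_. UNIV"]) (auto simp: mem_Times_iff)
    ultimately show "?j (?i x) = x" by (simp add: prod_eq_iff)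
    show "?i x \<in> upper_unipotent (Suc m)"
      using x by (auto simp: mem_upper_unipotent_iff mem_Times_iff)
  qed
  also have "\<dots> = (\<Sum>v\<in>?U. \<Sum>y\<in>{..<m} \<rightarrow>\<^sub>E UNIV. F y)"
    by (subst sum.cartesian_product) (simp add: case_prod_unfold)
  finally show ?thesis by simp
qed

lemma card_upper_unipotent_Suc:
  "card (upper_unipotent (Suc m) :: 'a::{field,finite} mat set) =
     card (upper_unipotent m :: 'a mat set) * CARD('a) ^ m"
  using sum_upper_unipotent_Suc[of "1 :: 'a" "\<lambda>_. 1 :: nat" m] by (simp add: card_PiE)

text \<open>The Kloosterman-type sum with last variable fixed to \<open>a\<close>: the extensional
  \<open>y\<close> holds the variables below \<open>m\<close>, and the update supplies
  \<open>z m\<close>.\<close>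

definition whittaker_sum ::
  "nat \<Rightarrow> (nat \<Rightarrow> 'a::field \<Rightarrow> complex) \<Rightarrow> ('a \<Rightarrow> complex) \<Rightarrow> 'a \<Rightarrow> complex" where
  "whittaker_sum m \<chi> \<psi> a =
     (\<Sum>y\<in>{..<m} \<rightarrow>\<^sub>E UNIV - {0}. whittaker_summand m \<chi> \<psi> (y(m := a)))"

text \<open>Only the factor for the last consecutive pair involves the updated position.\<close>

lemma whittaker_summand_Suc:
  "whittaker_summand (Suc m) \<chi> \<psi> (z(Suc m := a)) =
     \<chi> (Suc (Suc m)) (- (a / z m)) * \<psi> (- (z m / a)) * whittaker_summand m \<chi> \<psi> z"
proof -
  have "(\<Prod>k<m. \<chi> (Suc (Suc k)) (- ((z(Suc m := a)) (Suc k) / (z(Suc m := a)) k)) *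
        \<psi> (- ((z(Suc m := a)) k / (z(Suc m := a)) (Suc k)))) =
      (\<Prod>k<m. \<chi> (Suc (Suc k)) (- (z (Suc k) / z k)) * \<psi> (- (z k / z (Suc k))))"
    by (intro prod.cong) auto
  then show ?thesis
    by (simp add: whittaker_summand_def mult_ac)
qed

lemma whittaker_sum_Suc:
  fixes \<chi> :: "nat \<Rightarrow> 'a::{field,finite} \<Rightarrow> complex"
  shows "whittaker_sum (Suc m) \<chi> \<psi> a =
    (\<Sum>t\<in>UNIV - {0}. \<chi> (Suc (Suc m)) (- (a / t)) * \<psi> (- (t / a)) * whittaker_sum m \<chi> \<psi> t)"
proof -
  let ?N = "UNIV - {0} :: 'a set"
  have "whittaker_sum (Suc m) \<chi> \<psi> a =
      (\<Sum>x\<in>?N \<times> ({..<m} \<rightarrow>\<^sub>E ?N). whittaker_summand (Suc m) \<chi> \<psi> ((snd x)(m := fst x, Suc m := a)))"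
    unfolding whittaker_sum_def
  proof (rule sum.reindex_bij_witness[where
        \<comment> \<open>The variable \<open>y m\<close> becomes the outer summation variable;
          restricting the rest makes it extensional on \<open>{..<m}\<close> again.\<close>
        i = "\<lambda>x. (snd x)(m := fst x)" and j = "\<lambda>y. (y m, restrict y {..<m})"])
    fix y assume y: "y \<in> {..<Suc m} \<rightarrow>\<^sub>E ?N"
    show *: "(snd (y m, restrict y {..<m}))(m := fst (y m, restrict y {..<m})) = y"
    proof
      fix k
      consider "k < m" | "k = m" | "k \<notin> {..<Suc m}" by fastforce
      then show "((snd (y m, restrict y {..<m}))(m := fst (y m, restrict y {..<m}))) k = y k"
        using PiE_arb[OF y, of k] by cases simp_all
    qed
    have "y k \<in> ?N" if "k < Suc m" for k
      using PiE_mem[OF y, of k] that by simp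
    then show "(y m, restrict y {..<m}) \<in> ?N \<times> ({..<m} \<rightarrow>\<^sub>E ?N)"
      by (simp add: PiE_iff mem_Times_iff)
    show "whittaker_summand (Suc m) \<chi> \<psi> ((snd (y m, restrict y {..<m}))(m := fst (y m, restrict y {..<m}), Suc m := a)) =
        whittaker_summand (Suc m) \<chi> \<psi> (y(Suc m := a))"
      unfolding * ..
  next
    fix x assume x: "x \<in> ?N \<times> ({..<m} \<rightarrow>\<^sub>E ?N)"
    then have x': "fst x \<in> ?N" "snd x \<in> {..<m} \<rightarrow>\<^sub>E ?N" by (simp_all add: mem_Times_iff)
    have "restrict ((snd x)(m := fst x)) {..<m} = snd x"
    proof
      fix k show "restrict ((snd x)(m := fst x)) {..<m} k = snd x k"
        using PiE_arb[OF x'(2), of k] by (cases "k < m") simp_all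
    qed
    then show "(((snd x)(m := fst x)) m, restrict ((snd x)(m := fst x)) {..<m}) = x"
      by (simp add: prod_eq_iff)
    show "(snd x)(m := fst x) \<in> {..<Suc m} \<rightarrow>\<^sub>E ?N"
      using PiE_fun_upd[OF x'] by (simp add: lessThan_Suc)
  qed
  also have "\<dots> = (\<Sum>t\<in>?N. \<Sum>y\<in>{..<m} \<rightarrow>\<^sub>E ?N. whittaker_summand (Suc m) \<chi> \<psi> (y(m := t, Suc m := a)))"
    by (subst sum.cartesian_product) (simp add: case_prod_unfold)
  finally show ?thesis
    by (simp add: whittaker_summand_Suc whittaker_sum_def sum_distrib_left)
qed

lemma whittaker_function_antidiag:
  fixes \<psi> :: "'a::{field,finite} \<Rightarrow> complex"
  assumes \<chi>: "\<And>i. i \<in> {1..Suc m} \<Longrightarrow> multiplicative_character (\<chi> i)"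
    and \<psi>: "additive_character \<psi>" and m: "m \<ge> 1" and a: "a \<noteq> 0"
  shows "whittaker_function (Suc m) \<chi> \<psi> (antidiag_block (Suc m) 1 a) =
    of_nat (card (lower_borel (Suc m) :: 'a mat set)) / of_nat (card (GL (Suc m) :: 'a mat set)) *
    (of_nat (card (upper_unipotent m :: 'a mat set)) * whittaker_sum m \<chi> \<psi> a)"
proof -
  \<comment> \<open>Extension by zero to vectors with a vanishing coordinate: these are the last
    columns whose translates miss the big cell, so the sum may run over the whole unipotent
    group.\<close>
  define F where "F y = (if \<forall>k<m. y k \<noteq> 0 then whittaker_summand m \<chi> \<psi> (y(m := a)) else 0)" for y
  let ?h = "antidiag_block (Suc m) 1 a"
  have summand: "whittaker_vector (Suc m) \<chi> \<psi> (u * ?h) * cnj (unipotent_char (Suc m) \<psi> u) =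
      F (\<lambda>k\<in>{..<m}. a * u $$ (k, m))" if u: "u \<in> upper_unipotent (Suc m)" for u
  proof (cases "\<forall>k<m. u $$ (k, m) \<noteq> 0")
    case True
    let ?z = "(\<lambda>k\<in>{..<m}. a * u $$ (k, m))(m := a)"
    have "u $$ (m, m) = 1" using u by (simp add: mem_upper_unipotent_iff)
    then have "whittaker_vector (Suc m) \<chi> \<psi> (u * ?h) * cnj (unipotent_char (Suc m) \<psi> u) =
        whittaker_summand m \<chi> \<psi> ?z"
      using True a by (intro whittaker_vector_antidiag[OF \<chi> \<psi> m u a]) auto
    then show ?thesis using True a by (simp add: F_def)
  next
    case False
    then obtain k where k: "k < m" "u $$ (k, m) = 0" by blast
    then have "whittaker_vector (Suc m) \<chi> \<psi> (u * ?h) = 0"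
      using whittaker_vector_antidiag_eq_0[OF u a, of k] by simp
    moreover have "F (\<lambda>k\<in>{..<m}. a * u $$ (k, m)) = 0"
      using k by (auto simp: F_def)
    ultimately show ?thesis by simp
  qed
  have "(\<Sum>y\<in>{..<m} \<rightarrow>\<^sub>E UNIV. F y) = (\<Sum>y\<in>{..<m} \<rightarrow>\<^sub>E UNIV - {0}. F y)"
    by (intro sum.mono_neutral_right finite_PiE) (auto simp: F_def PiE_iff)
  also have "\<dots> = whittaker_sum m \<chi> \<psi> a"
    unfolding whittaker_sum_def by (intro sum.cong) (auto simp: F_def PiE_iff)
  finally have F: "(\<Sum>y\<in>{..<m} \<rightarrow>\<^sub>E UNIV. F y) = whittaker_sum m \<chi> \<psi> a" .
  have h: "?h \<in> GL (Suc m)" using a by (intro antidiag_block_in_GL) auto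
  have "(\<Sum>u\<in>upper_unipotent (Suc m). whittaker_vector (Suc m) \<chi> \<psi> (u * ?h) *
        cnj (unipotent_char (Suc m) \<psi> u)) =
      (\<Sum>u\<in>upper_unipotent (Suc m). F (\<lambda>k\<in>{..<m}. a * u $$ (k, m)))"
    using summand by (rule sum.cong[OF refl])
  also have "\<dots> = of_nat (card (upper_unipotent m :: 'a mat set)) * whittaker_sum m \<chi> \<psi> a"
    unfolding sum_upper_unipotent_Suc[OF a] F ..
  finally show ?thesis
    by (subst whittaker_function_eq_sum_unipotent[OF _ h]) (use \<chi> in auto)
qed

theorem theorem3p1:
  fixes \<psi> :: "'a::{field,finite} \<Rightarrow> complex"
    and \<chi> :: "nat \<Rightarrow> 'a \<Rightarrow> complex"
    and a :: 'a
    and n p k :: nat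
  assumes "prime p" and "odd p" and "CARD('a) = p ^ k"
    and "additive_character \<psi>" and "\<exists>x. \<psi> x \<noteq> 1"
    and "n \<ge> 3"
    and "\<And>i. i \<in> {1..n} \<Longrightarrow> multiplicative_character (\<chi> i)"
    and "a \<noteq> 0"
  shows "whittaker_function n \<chi> \<psi> (antidiag_block n 1 a) =
    of_nat (CARD('a) ^ (n - 2)) * (of_nat CARD('a) - 1) / (of_nat CARD('a) ^ n - 1) *
    (\<Sum>t\<in>UNIV - {0}. \<chi> n (- (a / t)) * \<psi> (- (t / a)) *
       whittaker_function (n - 1) \<chi> \<psi> (antidiag_block (n - 1) 1 t))"
proof -
  \<comment> \<open>The bound \<open>m \<ge> 1\<close> allows the closed formula to be applied at
    size \<open>n - 1\<close> as well as at size \<open>n\<close>.\<close>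
  obtain m where n: "n = Suc (Suc m)" and m: "m \<ge> 1"
    using \<open>n \<ge> 3\<close> by (metis One_nat_def Suc_le_D Suc_le_mono numeral_3_eq_3)
  let ?q = "of_nat CARD('a) :: complex"
  let ?B = "\<lambda>j. of_nat (card (lower_borel j :: 'a mat set)) :: complex"
  let ?G = "\<lambda>j. of_nat (card (GL j :: 'a mat set)) :: complex"
  let ?U = "\<lambda>j. of_nat (card (upper_unipotent j :: 'a mat set)) :: complex"
  let ?c = "\<lambda>t. \<chi> n (- (a / t)) * \<psi> (- (t / a))"
  have q: "CARD('a) \<ge> 2"
  proof -
    have "card {0, 1 :: 'a} \<le> CARD('a)" by (intro card_mono) auto
    then show ?thesis by simp
  qed
  then have q0: "?q \<noteq> 0" by simp
  \<comment> \<open>This turns the truncated subtraction in the order of \<open>GL n\<close> into a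
    complex one and keeps the denominator of the constant nonzero.\<close>
  have qn: "CARD('a) ^ n > 1"
    using q n by (intro one_less_power) auto
  then have qn0: "?q ^ n - 1 \<noteq> 0"
    by (metis eq_iff_diff_eq_0 less_irrefl of_nat_1 of_nat_eq_iff of_nat_power)
  have B: "?B n = ?B (Suc m) * ?q ^ Suc m * (?q - 1)"
    unfolding n card_lower_borel_Suc[of "Suc m"] using q by (simp add: of_nat_diff)
  have G: "?G n = (?q ^ n - 1) * (?G (Suc m) * ?q ^ Suc m)"
    using qn unfolding n card_GL_Suc[of "Suc m"] by (simp add: of_nat_diff del: power_Suc)
  have U: "?U (Suc m) = ?U m * ?q ^ m"
    by (simp add: card_upper_unipotent_Suc)
  have G0: "?G (Suc m) \<noteq> 0"
    using card_GL_pos[of "Suc m", where 'a = 'a] by simp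
  have 1: "whittaker_function n \<chi> \<psi> (antidiag_block n 1 a) =
      ?B n / ?G n * (?U (Suc m) * whittaker_sum (Suc m) \<chi> \<psi> a)"
    unfolding n using assms(4,7,8) n by (intro whittaker_function_antidiag) auto
  have 2: "whittaker_function (n - 1) \<chi> \<psi> (antidiag_block (n - 1) 1 t) =
      ?B (Suc m) / ?G (Suc m) * (?U m * whittaker_sum m \<chi> \<psi> t)" if "t \<noteq> 0" for t
    using that assms(4,7) n m whittaker_function_antidiag[of m \<chi> \<psi> t] by auto
  have "(\<Sum>t\<in>UNIV - {0}. ?c t * whittaker_function (n - 1) \<chi> \<psi> (antidiag_block (n - 1) 1 t)) =
      (\<Sum>t\<in>UNIV - {0}. ?B (Suc m) / ?G (Suc m) * ?U m * (?c t * whittaker_sum m \<chi> \<psi> t))"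
    by (intro sum.cong refl, subst 2) (simp_all add: mult_ac)
  also have "\<dots> = ?B (Suc m) / ?G (Suc m) * ?U m * whittaker_sum (Suc m) \<chi> \<psi> a"
    unfolding whittaker_sum_Suc n by (simp add: sum_distrib_left)
  finally have 3: "(\<Sum>t\<in>UNIV - {0}. ?c t * whittaker_function (n - 1) \<chi> \<psi> (antidiag_block (n - 1) 1 t)) =
      ?B (Suc m) / ?G (Suc m) * ?U m * whittaker_sum (Suc m) \<chi> \<psi> a" .
  \<comment> \<open>From size \<open>n - 1\<close> to \<open>n\<close>, \<open>?B\<close> gains
    \<open>?q ^ Suc m * (?q - 1)\<close> and \<open>?G\<close> gains
    \<open>(?q ^ n - 1) * ?q ^ Suc m\<close>, so the powers cancel; the remaining
    \<open>?q ^ m\<close> comes from \<open>?U\<close>.\<close>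
  have "?B n / ?G n * ?U (Suc m) = ?q ^ m * (?q - 1) / (?q ^ n - 1) * (?B (Suc m) / ?G (Suc m) * ?U m)"
    unfolding B G U using q0 qn0 G0 by (simp add: field_simps del: power_Suc)
  moreover have "of_nat (CARD('a) ^ (n - 2)) = ?q ^ m" by (simp add: n)
  ultimately show ?thesis
    unfolding 1 3 by (metis mult.assoc)
qed

end
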